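(* Let $X,Y$ be Tychonoff spaces with countable tightness. If the linear topological spaces $SC_p(X)$ and $SC_p(Y)$ are topologically isomorphic (i.e., there is a linear homeomorphism between them), then $nw(X)=nw(Y)$.
   Context: A function $f:X\to Y$ between topological spaces is scatteredly continuous if for each non-empty subspace $A\subset X$ the restriction $f|A:A\to Y$ has a point of continuity. $SC_p(X)\subset\mathbb R^X$ denotes the linear space of all scatteredly continuous real-valued functions on $X$, endowed with the topology of pointwise convergence. A network of a topological space is a family $\mathcal N$ of subsets such that for each open set $U$ and each $x\in U$ there is $N\in\mathcal N$ with $x\in N\subset U$. The network weight $nw(X)$ is the smallest cardinality of a network of $X$. $X$ has countable tightness if for each $A\subset X$ and $a\in\bar A$ there is a countable $B\subset A$ with $a\in\bar B$. *)

theory Defs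
  imports "HOL-Analysis.Analysis"
begin

unbundle cardinal_syntax

definition Tychonoff_space :: "'a topology \<Rightarrow> bool"
  where "Tychonoff_space X \<longleftrightarrow> completely_regular_space X \<and> t1_space X"

definition countably_tight :: "'a topology \<Rightarrow> bool"
  where "countably_tight X \<longleftrightarrow>
    (\<forall>A \<subseteq> topspace X. \<forall>a \<in> X closure_of A. \<exists>B \<subseteq> A. countable B \<and> a \<in> X closure_of B)"

definition network :: "'a topology \<Rightarrow> 'a set set \<Rightarrow> bool"
  where "network X \<N> \<longleftrightarrow> \<N> \<subseteq> Pow (topspace X) \<and>
    (\<forall>U x. openin X U \<and> x \<in> U \<longrightarrow> (\<exists>N\<in>\<N>. x \<in> N \<and> N \<subseteq> U))"

text \<open>The network weight is a cardinal, represented (up to \<open>=o\<close>) by the cardinal order of a network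
  of least cardinality.  No infinite lower bound is built in: finite values are allowed.\<close>

definition network_weight :: "'a topology \<Rightarrow> 'a set rel"
  where "network_weight X = |SOME \<N>. network X \<N> \<and> (\<forall>\<M>. network X \<M> \<longrightarrow> |\<N>| \<le>o |\<M>| )|"

lemma network_weight_least:
  shows "\<exists>\<N>. network X \<N> \<and> network_weight X = |\<N>|"
    and "network X \<M> \<Longrightarrow> network_weight X \<le>o |\<M>|"
proof -
  let ?P = "\<lambda>\<N>. network X \<N> \<and> (\<forall>\<M>. network X \<M> \<longrightarrow> |\<N>| \<le>o |\<M>| )"
  let ?R = "card_of ` {\<N>. network X \<N>}"
  have "network X (Pow (topspace X))"
    unfolding network_def using openin_subset by blast
  then have "?R \<noteq> {}" by blast
  moreover have "\<forall>r\<in>?R. Card_order r"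
    using card_of_Card_order by blast
  ultimately obtain r where "r \<in> ?R" "\<forall>s\<in>?R. r \<le>o s"
    using exists_minim_Card_order[of ?R] by blast
  then have "\<exists>\<N>. ?P \<N>" by blast
  then have "?P (SOME \<N>. ?P \<N>)" by (rule someI_ex)
  then show "\<exists>\<N>. network X \<N> \<and> network_weight X = |\<N>|"
    and "network X \<M> \<Longrightarrow> network_weight X \<le>o |\<M>|"
    unfolding network_weight_def by blast+
qed

definition scatteredly_continuous :: "'a topology \<Rightarrow> 'b topology \<Rightarrow> ('a \<Rightarrow> 'b) \<Rightarrow> bool"
  where "scatteredly_continuous X Y f \<longleftrightarrow> f \<in> topspace X \<rightarrow> topspace Y \<and>
    (\<forall>A \<subseteq> topspace X. A \<noteq> {} \<longrightarrow> (\<exists>a\<in>A. topcontinuous_at (subtopology X A) Y f a))"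

text \<open>Real functions on the space \<open>X\<close> are represented by functions that are \<open>undefined\<close> outside
  \<open>topspace X\<close>, as in \<^const>\<open>product_topology\<close>; the vector space operations are therefore the pointwise
  ones restricted to \<open>topspace X\<close>.\<close>

definition SC :: "'a topology \<Rightarrow> ('a \<Rightarrow> real) set"
  where "SC X = {f \<in> extensional (topspace X). scatteredly_continuous X euclideanreal f}"

definition SC_p :: "'a topology \<Rightarrow> ('a \<Rightarrow> real) topology"
  where "SC_p X = subtopology (powertop_real (topspace X)) (SC X)"

definition SC_linear :: "'a topology \<Rightarrow> 'b topology \<Rightarrow> (('a \<Rightarrow> real) \<Rightarrow> ('b \<Rightarrow> real)) \<Rightarrow> bool"
  where "SC_linear X Y T \<longleftrightarrow>
    (\<forall>f\<in>SC X. \<forall>g\<in>SC X.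
       T (\<lambda>x\<in>topspace X. f x + g x) = (\<lambda>y\<in>topspace Y. T f y + T g y)) \<and>
    (\<forall>c::real. \<forall>f\<in>SC X.
       T (\<lambda>x\<in>topspace X. c * f x) = (\<lambda>y\<in>topspace Y. c * T f y))"

definition SC_p_linearly_homeomorphic :: "'a topology \<Rightarrow> 'b topology \<Rightarrow> bool"
  where "SC_p_linearly_homeomorphic X Y \<longleftrightarrow>
    (\<exists>T. homeomorphic_map (SC_p X) (SC_p Y) T \<and> SC_linear X Y T)"

lemma topspace_SC_p: "topspace (SC_p X) = SC X"
  by (auto simp: SC_p_def SC_def PiE_def)

end

theory Submission
  imports Defs
begin

text \<open>Let \<open>T\<close> be a linear homeomorphism from \<open>SC_p(X)\<close> onto \<open>SC_p(Y)\<close> and \<open>F\<close> the image under \<open>T\<close> of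
  the set \<open>C\<close> of continuous functions with values in \<open>[-1, 1]\<close>. Series of elements of \<open>C\<close> with summable
  positive coefficients converge to continuous functions, hence the corresponding series of elements
  of \<open>F\<close> converge to scatteredly continuous functions; in particular \<open>F\<close> is pointwise bounded. If \<open>F\<close>
  is bounded by a constant on \<open>A \<subseteq> Y\<close>, then all \<open>f \<in> F\<close> are continuous on a common nonempty
  relatively open subset of \<open>A\<close>: otherwise countable tightness yields a countable subset of \<open>A\<close> and a
  sequence in \<open>F\<close> some series of which is discontinuous at a dense set of its points, and this is
  impossible for a scatteredly continuous function. The choice of the series uses the uniform bound, so
  \<open>Y\<close> is cut into the countably many pieces on which \<open>F\<close> is bounded by a given integer. If \<open>Y\<close> has an
  infinite network of cardinality \<open>\<kappa>\<close>, it follows that \<open>\<kappa>\<close> sets suffice to control the oscillation of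
  all \<open>f \<in> F\<close>; they provide a network of \<open>\<kappa>\<close> sets for \<open>F\<close>, and, as \<open>X\<close> embeds into the space of
  functions on \<open>C\<close>, also for \<open>X\<close>. If \<open>Y\<close> has a finite network, it is finite, and
  \<open>|X| \<le> |Y|\<close> by comparison of dimensions.\<close>

section \<open>Continuity of a real function relative to a subset\<close>

text \<open>Continuity at \<open>a\<close> of the restriction to \<open>A\<close>, with
  neighbourhoods taken in \<open>Y\<close> itself, so that \<open>A\<close> can be varied without
  passing through subtopologies.\<close>

definition cont_at :: "'a topology \<Rightarrow> 'a set \<Rightarrow> ('a \<Rightarrow> real) \<Rightarrow> 'a \<Rightarrow> bool"
  where "cont_at Y A f a \<longleftrightarrow>
    (\<forall>\<epsilon>>0. \<exists>V. openin Y V \<and> a \<in> V \<and> (\<forall>x\<in>V \<inter> A. \<bar>f x - f a\<bar> < \<epsilon>))"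

lemma cont_atD:
  assumes "cont_at Y A f a" and "0 < \<epsilon>"
  obtains V where "openin Y V" "a \<in> V" "\<And>x. \<lbrakk>x \<in> V; x \<in> A\<rbrakk> \<Longrightarrow> \<bar>f x - f a\<bar> < \<epsilon>"
  using assms unfolding cont_at_def by (metis IntI)

lemma not_cont_atE:
  assumes "\<not> cont_at Y A f a"
  obtains \<epsilon> where "0 < \<epsilon>"
    and "\<And>V. \<lbrakk>openin Y V; a \<in> V\<rbrakk> \<Longrightarrow> \<exists>x\<in>V \<inter> A. \<not> \<bar>f x - f a\<bar> < \<epsilon>"
  using assms unfolding cont_at_def by metis

lemma topcontinuous_at_subtopology_real_iff:
  assumes "A \<subseteq> topspace Y" and "a \<in> A"
  shows "topcontinuous_at (subtopology Y A) euclideanreal f a \<longleftrightarrow> cont_at Y A f a"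
proof
  assume L: "topcontinuous_at (subtopology Y A) euclideanreal f a"
  show "cont_at Y A f a"
    unfolding cont_at_def
  proof (intro allI impI)
    fix \<epsilon> :: real assume "0 < \<epsilon>"
    then have "open (ball (f a) \<epsilon>)" "f a \<in> ball (f a) \<epsilon>" by auto
    with L obtain U where U: "openin (subtopology Y A) U" "a \<in> U" "\<forall>y\<in>U. f y \<in> ball (f a) \<epsilon>"
      unfolding topcontinuous_at_def by (metis open_openin)
    then obtain V where "openin Y V" "U = V \<inter> A"
      by (auto simp: openin_subtopology)
    with U show "\<exists>V. openin Y V \<and> a \<in> V \<and> (\<forall>x\<in>V \<inter> A. \<bar>f x - f a\<bar> < \<epsilon>)"
      by (intro exI[of _ V]) (auto simp: dist_real_def abs_minus_commute)
  qed
next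
  assume R: "cont_at Y A f a"
  show "topcontinuous_at (subtopology Y A) euclideanreal f a"
    unfolding topcontinuous_at_def
  proof (intro conjI allI impI)
    fix W assume W: "openin euclideanreal W \<and> f a \<in> W"
    then obtain \<epsilon> where "0 < \<epsilon>" and \<epsilon>: "\<And>y. \<bar>y - f a\<bar> < \<epsilon> \<Longrightarrow> y \<in> W"
      by (metis dist_real_def open_dist open_openin)
    with cont_atD[OF R] obtain V where "openin Y V" "a \<in> V"
      "\<And>x. \<lbrakk>x \<in> V; x \<in> A\<rbrakk> \<Longrightarrow> \<bar>f x - f a\<bar> < \<epsilon>" by metis
    with \<epsilon> assms show "\<exists>U. openin (subtopology Y A) U \<and> a \<in> U \<and> (\<forall>y\<in>U. f y \<in> W)"
      by (intro exI[of _ "V \<inter> A"]) (auto simp: openin_subtopology)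
  qed (use assms in auto)
qed

lemma cont_at_cong:
  assumes "cont_at Y A f a" and "a \<in> A" and "\<And>x. x \<in> A \<Longrightarrow> f x = g x"
  shows "cont_at Y A g a"
  using assms unfolding cont_at_def by simp

lemma cont_at_linear_combination:
  assumes "cont_at Y A f a" and "cont_at Y A g a"
  shows "cont_at Y A (\<lambda>x. b * f x + c * g x) a"
  unfolding cont_at_def
proof (intro allI impI)
  fix \<epsilon> :: real assume "0 < \<epsilon>"
  define s where "s = \<bar>b\<bar> + \<bar>c\<bar> + 1"
  have "0 < s" unfolding s_def by linarith
  define \<delta> where "\<delta> = \<epsilon> / s"
  have "0 < \<delta>" using \<open>0 < \<epsilon>\<close> \<open>0 < s\<close> by (simp add: \<delta>_def)
  obtain V where V: "openin Y V" "a \<in> V" "\<And>x. \<lbrakk>x \<in> V; x \<in> A\<rbrakk> \<Longrightarrow> \<bar>f x - f a\<bar> < \<delta>"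
    using cont_atD[OF assms(1) \<open>0 < \<delta>\<close>] by metis
  obtain W where W: "openin Y W" "a \<in> W" "\<And>x. \<lbrakk>x \<in> W; x \<in> A\<rbrakk> \<Longrightarrow> \<bar>g x - g a\<bar> < \<delta>"
    using cont_atD[OF assms(2) \<open>0 < \<delta>\<close>] by metis
  have "\<bar>b * f x + c * g x - (b * f a + c * g a)\<bar> < \<epsilon>" if "x \<in> V \<inter> W" "x \<in> A" for x
  proof -
    have "b * f x + c * g x - (b * f a + c * g a) = b * (f x - f a) + c * (g x - g a)"
      by (simp add: algebra_simps)
    then have "\<bar>b * f x + c * g x - (b * f a + c * g a)\<bar> \<le> \<bar>b\<bar> * \<bar>f x - f a\<bar> + \<bar>c\<bar> * \<bar>g x - g a\<bar>"
      by (metis abs_mult abs_triangle_ineq)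
    also have "\<dots> \<le> \<bar>b\<bar> * \<delta> + \<bar>c\<bar> * \<delta>"
      using V(3)[of x] W(3)[of x] that by (intro add_mono mult_left_mono) auto
    also have "\<dots> < s * \<delta>" using \<open>0 < \<delta>\<close> by (simp add: s_def algebra_simps)
    also have "\<dots> = \<epsilon>" using \<open>0 < s\<close> by (simp add: \<delta>_def)
    finally show ?thesis .
  qed
  with V W show "\<exists>V. openin Y V \<and> a \<in> V \<and>
      (\<forall>x\<in>V \<inter> A. \<bar>b * f x + c * g x - (b * f a + c * g a)\<bar> < \<epsilon>)"
    by (intro exI[of _ "V \<inter> W"]) (auto intro: openin_Int)
qed

section \<open>Series of scatteredly continuous functions\<close>

text \<open>The restriction of \<open>g\<close> to \<open>D\<close> is continuous at some
  \<open>d\<close> in \<open>D\<close>. If \<open>D\<close> were dense in \<open>Q\<close>, then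
  near \<open>d\<close> each value of \<open>g\<close> at a continuity point would be approximated
  by values at points of \<open>D\<close>, which are close to \<open>g d\<close>. So
  \<open>g\<close> would be continuous at \<open>d\<close> on \<open>Q\<close>.\<close>

lemma scatteredly_continuous_discontinuities_not_dense:
  assumes sc: "scatteredly_continuous Y euclideanreal g" and "Q \<subseteq> topspace Y"
    and "D = {x\<in>Q. \<not> cont_at Y Q g x}" and "D \<noteq> {}"
  shows "\<not> Q \<subseteq> Y closure_of D"
proof
  assume dense: "Q \<subseteq> Y closure_of D"
  have "D \<subseteq> Q" "D \<subseteq> topspace Y" using assms by auto
  then obtain d where "d \<in> D" and d: "cont_at Y D g d"
    using sc \<open>D \<noteq> {}\<close> topcontinuous_at_subtopology_real_iff[of D Y]
    unfolding scatteredly_continuous_def by metis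
  have "cont_at Y Q g d"
    unfolding cont_at_def
  proof (intro allI impI)
    fix \<epsilon> :: real assume "0 < \<epsilon>"
    then obtain V where V: "openin Y V" "d \<in> V" "\<And>x. \<lbrakk>x \<in> V; x \<in> D\<rbrakk> \<Longrightarrow> \<bar>g x - g d\<bar> < \<epsilon>/2"
      using cont_atD[OF d, of "\<epsilon>/2"] by (metis half_gt_zero)
    have "\<bar>g x - g d\<bar> < \<epsilon>" if "x \<in> V" "x \<in> Q" for x
    proof (cases "x \<in> D")
      case True
      then show ?thesis using V(3)[of x] that by linarith
    next
      case False
      then have "cont_at Y Q g x" using assms that by auto
      then obtain W where W: "openin Y W" "x \<in> W" "\<And>z. \<lbrakk>z \<in> W; z \<in> Q\<rbrakk> \<Longrightarrow> \<bar>g z - g x\<bar> < \<epsilon>/2"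
        using cont_atD[of Y Q g x "\<epsilon>/2"] \<open>0 < \<epsilon>\<close> by (metis half_gt_zero)
      have "openin Y (V \<inter> W)" "x \<in> V \<inter> W" using V W that by auto
      then obtain z where "z \<in> D" "z \<in> V \<inter> W"
        using dense \<open>x \<in> Q\<close> by (meson in_closure_of subsetD)
      then have "\<bar>g z - g d\<bar> < \<epsilon>/2" "\<bar>g z - g x\<bar> < \<epsilon>/2"
        using V(3)[of z] W(3)[of z] \<open>D \<subseteq> Q\<close> by blast+
      then show ?thesis by linarith
    qed
    with V show "\<exists>V. openin Y V \<and> d \<in> V \<and> (\<forall>x\<in>V \<inter> Q. \<bar>g x - g d\<bar> < \<epsilon>)" by blast
  qed
  with \<open>d \<in> D\<close> assms show False by blast
qed

text \<open>If \<open>h + d \<cdot> f\<close> and \<open>h + d/2 \<cdot> f\<close> were both continuous at a point, so would be \<open>f\<close>. Hence the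
  coefficients can be chosen one after the other, each so small that it does not spoil the
  discontinuities obtained before.\<close>

lemma exists_series_discontinuous_at_sequence:
  fixes f :: "nat \<Rightarrow> 'a \<Rightarrow> real"
  assumes disc: "\<And>n. \<not> cont_at Y Q (f n) (q n)" and q: "\<And>n. q n \<in> Q"
    and bound: "\<And>n x. x \<in> Q \<Longrightarrow> \<bar>f n x\<bar> \<le> m"
  obtains t where "\<And>n. 0 < t n" and "summable t"
    and "\<And>g n. \<forall>x\<in>Q. (\<lambda>k. t k * f k x) sums g x \<Longrightarrow> \<not> cont_at Y Q g (q n)"
proof -
  define M where "M = max m 1"
  have M: "0 < M" and fM: "\<And>n x. x \<in> Q \<Longrightarrow> \<bar>f n x\<bar> \<le> M"
    using bound unfolding M_def by (auto simp: max.coboundedI1)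
  \<comment> \<open>Failure of \<open>near e h p\<close> is a discontinuity with a jump of size at
    least \<open>e\<close>. Such a jump survives in smaller size when a sufficiently small function
    is added.\<close>
  define near where "near e h p \<longleftrightarrow> (\<exists>V. openin Y V \<and> p \<in> V \<and> (\<forall>x\<in>V \<inter> Q. \<bar>h x - h p\<bar> < e))"
    for e :: real and h :: "'a \<Rightarrow> real" and p
  have near_mono: "near e' h p" if "near e h p" "e \<le> e'" for e e' h p
    using that unfolding near_def by (meson less_le_trans)
  have step: "\<exists>t e. 0 < t \<and> t \<le> d \<and> 0 < e \<and> e \<le> d \<and> \<not> near e (\<lambda>x. h x + t * f n x) (q n)"
    if "0 < d" for d h n
  proof -
    have "\<exists>t. 0 < t \<and> t \<le> d \<and> \<not> cont_at Y Q (\<lambda>x. h x + t * f n x) (q n)"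
    proof (rule ccontr)
      assume "\<not> ?thesis"
      then have "cont_at Y Q (\<lambda>x. h x + d * f n x) (q n)"
        "cont_at Y Q (\<lambda>x. h x + d/2 * f n x) (q n)"
        using \<open>0 < d\<close> by (metis order_refl, metis field_sum_of_halves half_gt_zero le_add_same_cancel2 less_le)
      from cont_at_linear_combination[OF this, of "2/d" "- 2/d"] have "cont_at Y Q (f n) (q n)"
        using \<open>0 < d\<close> by (simp add: field_simps)
      with disc show False by blast
    qed
    then obtain t where t: "0 < t" "t \<le> d" "\<not> cont_at Y Q (\<lambda>x. h x + t * f n x) (q n)" by blast
    then obtain e where "0 < e" "\<not> near e (\<lambda>x. h x + t * f n x) (q n)"
      unfolding cont_at_def near_def by blast
    then have "0 < min e d" "\<not> near (min e d) (\<lambda>x. h x + t * f n x) (q n)"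
      using \<open>0 < d\<close> near_mono by (auto simp: min_def)
    with t show ?thesis by (meson min.cobounded2)
  qed
  \<comment> \<open>A state holds the partial sum up to index \<open>n\<close>, its last coefficient
    and a jump size at \<open>q n\<close>. The relation \<open>R\<close> makes the next coefficient
    small compared with the jump already secured.\<close>
  define P where "P n s \<longleftrightarrow> (case s of (h, t, e) \<Rightarrow> 0 < t \<and> 0 < e \<and> \<not> near e h (q n)
    \<and> (n = 0 \<longrightarrow> h = (\<lambda>x. t * f 0 x)))" for n and s :: "('a \<Rightarrow> real) \<times> real \<times> real"
  define R where "R n s s' \<longleftrightarrow> (case s of (h, t, e) \<Rightarrow> case s' of (h', t', e') \<Rightarrow>
     h' = (\<lambda>x. h x + t' * f (Suc n) x) \<and> t' \<le> e / (8 * M) \<and> e' \<le> e / 2)"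
    for n and s s' :: "('a \<Rightarrow> real) \<times> real \<times> real"
  have "\<exists>s. P 0 s"
    using step[of 1 "\<lambda>x. 0" 0] by (auto simp: P_def)
  moreover have "\<exists>s'. P (Suc n) s' \<and> R n s s'" if "P n s" for n s
  proof -
    obtain h t e where s: "s = (h, t, e)" by (cases s)
    define d where "d = min (e / (8 * M)) (e / 2)"
    have "0 < d" using that M by (simp add: s P_def d_def)
    from step[OF this, of h "Suc n"] obtain t' e' where
      "0 < t'" "t' \<le> d" "0 < e'" "e' \<le> d" "\<not> near e' (\<lambda>x. h x + t' * f (Suc n) x) (q (Suc n))"
      by blast
    then show ?thesis
      by (intro exI[of _ "(\<lambda>x. h x + t' * f (Suc n) x, t', e')"]) (auto simp: s P_def R_def d_def)
  qed
  ultimately obtain s where s: "\<And>n. P n (s n)" "\<And>n. R n (s n) (s (Suc n))"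
    using dependent_nat_choice[of P R] by blast
  define h where "h n = fst (s n)" for n
  define t where "t n = fst (snd (s n))" for n
  define e where "e n = snd (snd (s n))" for n
  have s_eq: "s n = (h n, t n, e n)" for n by (simp add: h_def t_def e_def)
  have t_pos: "0 < t n" and e_pos: "0 < e n" and far: "\<not> near (e n) (h n) (q n)" for n
    using s(1)[of n] by (auto simp: P_def s_eq)
  have h0: "h 0 = (\<lambda>x. t 0 * f 0 x)" using s(1)[of 0] by (auto simp: P_def s_eq)
  have hS: "h (Suc n) = (\<lambda>x. h n x + t (Suc n) * f (Suc n) x)"
    and tS: "t (Suc n) \<le> e n / (8 * M)" and eS: "e (Suc n) \<le> e n / 2" for n
    using s(2)[of n] by (auto simp: R_def s_eq)
  have h_sum: "h n x = (\<Sum>k<Suc n. t k * f k x)" for n x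
    by (induction n) (simp_all add: h0 hS)
  have e_decay: "e (n + k) \<le> e n * (1/2) ^ k" for n k
  proof (induction k)
    case (Suc k)
    then show ?case using eS[of "n + k"] by simp
  qed simp
  \<comment> \<open>The constants in \<open>R\<close> serve this bound: multiplied by
    \<open>M\<close>, the coefficients after index \<open>n\<close> add up to at most
    \<open>e n / 4\<close>.\<close>
  have t_decay: "t (k + Suc n) \<le> e n / (8 * M) * (1/2) ^ k" for n k
  proof -
    have "t (k + Suc n) \<le> e (n + k) / (8 * M)" using tS[of "n + k"] by (simp add: add.commute)
    also have "\<dots> \<le> e n * (1/2) ^ k / (8 * M)"
      using e_decay[of n k] M by (intro divide_right_mono) auto
    finally show ?thesis by simp
  qed
  have "summable (\<lambda>k. t (k + Suc 0))"
  proof (rule summable_comparison_test)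
    show "\<exists>N. \<forall>k\<ge>N. norm (t (k + Suc 0)) \<le> e 0 / (8 * M) * (1/2) ^ k"
      using t_decay[of _ 0] t_pos by (simp add: less_imp_le abs_of_pos)
    show "summable (\<lambda>k. e 0 / (8 * M) * (1/2) ^ k)"
      by (intro summable_mult summable_geometric) simp
  qed
  then have "summable t" by (simp only: summable_iff_shift)
  have "\<not> cont_at Y Q g (q n)" if g: "\<forall>x\<in>Q. (\<lambda>k. t k * f k x) sums g x" for g n
  proof
    assume "cont_at Y Q g (q n)"
    then obtain V where V: "openin Y V" "q n \<in> V" "\<And>x. \<lbrakk>x \<in> V; x \<in> Q\<rbrakk> \<Longrightarrow> \<bar>g x - g (q n)\<bar> < e n / 2"
      using cont_atD[of Y Q g "q n" "e n / 2"] e_pos[of n] by (metis half_gt_zero)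
    have tail: "\<bar>g x - h n x\<bar> \<le> e n / 4" if "x \<in> Q" for x
    proof -
      let ?a = "\<lambda>k. t (k + Suc n) * f (k + Suc n) x"
      have a: "?a sums (g x - h n x)"
        using sums_iff_shift[of "\<lambda>k. t k * f k x" "Suc n" "g x - h n x"] bspec[OF g that]
        by (simp add: h_sum)
      have le: "norm (?a k) \<le> e n / 8 * (1/2) ^ k" for k
      proof -
        have "norm (?a k) \<le> t (k + Suc n) * M"
          using fM[OF that] t_pos[of "k + Suc n"] by (simp add: abs_mult mult_left_mono)
        also have "\<dots> \<le> (e n / (8 * M) * (1/2) ^ k) * M"
          using t_decay M by (intro mult_right_mono) auto
        also have "\<dots> = e n / 8 * (1/2) ^ k" using M by simp
        finally show ?thesis .
      qed
      have "norm (suminf ?a) \<le> (\<Sum>k. e n / 8 * (1/2) ^ k)"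
        using le by (rule norm_suminf_le) (intro summable_mult summable_geometric, simp)
      also have "\<dots> = e n / 4"
        using suminf_mult[OF summable_geometric, of "1/2 :: real" "e n / 8"] suminf_geometric[of "1/2::real"]
        by simp
      finally show ?thesis using sums_unique[OF a] by simp
    qed
    \<comment> \<open>A variation of \<open>g\<close> below \<open>e n / 2\<close> and two tails of
      at most \<open>e n / 4\<close> stay below the jump \<open>e n\<close> of the partial
      sum.\<close>
    have "\<bar>h n x - h n (q n)\<bar> < e n" if "x \<in> V \<inter> Q" for x
    proof -
      have "\<bar>g x - g (q n)\<bar> < e n / 2" "\<bar>g x - h n x\<bar> \<le> e n / 4"
        using V(3) tail that by blast+
      with tail[OF q, of n] show ?thesis by linarith
    qed
    with V(1,2) have "near (e n) (h n) (q n)" unfolding near_def by blast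
    with far show False by blast
  qed
  with t_pos \<open>summable t\<close> show thesis by (rule that)
qed

text \<open>A closing-off argument: to each point are attached a countable set of discontinuity
  points accumulating at it and, if it is a discontinuity point itself, a countable set witnessing
  this. Countable tightness supplies both, and countably many rounds from one point give
  \<open>Q\<close>.\<close>

lemma countable_dense_discontinuities:
  assumes tight: "countably_tight Y" and A: "A \<subseteq> topspace Y" "A \<noteq> {}"
    and dense: "A \<subseteq> Y closure_of {a\<in>A. \<exists>f\<in>F. \<not> cont_at Y A f a}"
  obtains Q D where "countable Q" and "Q \<subseteq> A" and "D \<subseteq> Q" and "D \<noteq> {}" and "Q \<subseteq> Y closure_of D"
    and "\<And>q. q \<in> D \<Longrightarrow> \<exists>f\<in>F. \<not> cont_at Y Q f q"
proof -
  define D0 where "D0 = {a\<in>A. \<exists>f\<in>F. \<not> cont_at Y A f a}"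
  have tightD: "\<exists>B\<subseteq>S. countable B \<and> a \<in> Y closure_of B" if "S \<subseteq> A" "a \<in> Y closure_of S" for S a
    using tight A that unfolding countably_tight_def by (meson order_trans)
  \<comment> \<open>Quantifying over all supersets \<open>R\<close> of \<open>C\<close> lets the
    discontinuity pass to the set \<open>Q\<close>, which is constructed only later.\<close>
  define witness where "witness a C \<longleftrightarrow> C \<subseteq> A \<and> countable C \<and>
    (a \<in> D0 \<longrightarrow> (\<exists>f\<in>F. \<forall>R. C \<subseteq> R \<longrightarrow> \<not> cont_at Y R f a))" for a C
  have "\<exists>C. witness a C" if "a \<in> A" for a
  proof (cases "a \<in> D0")
    case True
    then obtain f where f: "f \<in> F" "\<not> cont_at Y A f a" unfolding D0_def by blast
    from not_cont_atE[OF this(2)] obtain \<epsilon> where "0 < \<epsilon>"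
      and *: "\<And>V. \<lbrakk>openin Y V; a \<in> V\<rbrakk> \<Longrightarrow> \<exists>x\<in>V \<inter> A. \<not> \<bar>f x - f a\<bar> < \<epsilon>" by blast
    have "a \<in> Y closure_of {x\<in>A. \<not> \<bar>f x - f a\<bar> < \<epsilon>}"
      unfolding in_closure_of using * A \<open>a \<in> A\<close> by blast
    then obtain C where C: "C \<subseteq> {x\<in>A. \<not> \<bar>f x - f a\<bar> < \<epsilon>}" "countable C" "a \<in> Y closure_of C"
      using tightD[of "{x\<in>A. \<not> \<bar>f x - f a\<bar> < \<epsilon>}" a] by blast
    have "\<not> cont_at Y R f a" if "C \<subseteq> R" for R
    proof
      assume "cont_at Y R f a"
      from cont_atD[OF this \<open>0 < \<epsilon>\<close>] obtain V where
        "openin Y V" "a \<in> V" "\<And>x. \<lbrakk>x \<in> V; x \<in> R\<rbrakk> \<Longrightarrow> \<bar>f x - f a\<bar> < \<epsilon>" by metis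
      with C that show False unfolding in_closure_of by blast
    qed
    with C f show ?thesis unfolding witness_def by blast
  next
    case False
    then have "witness a {}" by (auto simp: witness_def)
    then show ?thesis by blast
  qed
  then obtain C where "\<And>a. a \<in> A \<Longrightarrow> witness a (C a)" by metis
  then have C: "\<And>a. a \<in> A \<Longrightarrow> C a \<subseteq> A" "\<And>a. a \<in> A \<Longrightarrow> countable (C a)"
    "\<And>a. a \<in> D0 \<Longrightarrow> \<exists>f\<in>F. \<forall>R. C a \<subseteq> R \<longrightarrow> \<not> cont_at Y R f a"
    unfolding witness_def D0_def by blast+
  have "\<exists>B\<subseteq>D0. countable B \<and> a \<in> Y closure_of B" if "a \<in> A" for a
    using tightD[of D0 a] dense that unfolding D0_def by blast
  then obtain B where B: "\<And>a. a \<in> A \<Longrightarrow> B a \<subseteq> D0" "\<And>a. a \<in> A \<Longrightarrow> countable (B a)"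
    "\<And>a. a \<in> A \<Longrightarrow> a \<in> Y closure_of (B a)"
    by metis
  obtain a0 where "a0 \<in> A" using A by blast
  \<comment> \<open>The union \<open>Q\<close> of these stages contains \<open>B a\<close> and
    \<open>C a\<close> for each of its points \<open>a\<close>.\<close>
  define S where "S n = ((\<lambda>S. S \<union> (\<Union>a\<in>S. B a \<union> C a)) ^^ n) {a0}" for n
  define Q where "Q = (\<Union>n. S n)"
  have S: "S n \<subseteq> A \<and> countable (S n)" for n
  proof (induction n)
    case 0
    then show ?case using \<open>a0 \<in> A\<close> by (simp add: S_def)
  next
    case (Suc n)
    have "S (Suc n) = S n \<union> (\<Union>a\<in>S n. B a \<union> C a)" by (simp add: S_def)
    moreover have "B a \<union> C a \<subseteq> A \<and> countable (B a \<union> C a)" if "a \<in> S n" for a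
    proof -
      have "a \<in> A" using that Suc by blast
      from B(1,2)[OF this] C(1,2)[OF this] show ?thesis by (auto simp: D0_def)
    qed
    ultimately show ?case using Suc by auto
  qed
  have "a0 \<in> S 0" by (simp add: S_def)
  have Q: "countable Q" "Q \<subseteq> A" "Q \<noteq> {}"
    using S \<open>a0 \<in> S 0\<close> unfolding Q_def by auto
  have closed: "B a \<union> C a \<subseteq> Q" if a: "a \<in> Q" for a
  proof -
    obtain n where "a \<in> S n" using a by (auto simp: Q_def)
    then have "B a \<union> C a \<subseteq> S (Suc n)" by (auto simp: S_def)
    then show ?thesis by (auto simp: Q_def)
  qed
  have dense': "Q \<subseteq> Y closure_of (Q \<inter> D0)"
  proof
    fix a assume "a \<in> Q"
    then have "B a \<subseteq> Q \<inter> D0" "a \<in> Y closure_of (B a)" using Q B closed by blast+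
    then show "a \<in> Y closure_of (Q \<inter> D0)" using closure_of_mono by blast
  qed
  then have "Q \<inter> D0 \<noteq> {}" using \<open>Q \<noteq> {}\<close> by (metis closure_of_empty subset_empty)
  moreover have "\<exists>f\<in>F. \<not> cont_at Y Q f q" if "q \<in> Q \<inter> D0" for q
    using C(3)[of q] closed[of q] that by blast
  ultimately show thesis using that[OF Q(1,2) Int_lower1 _ dense'] by blast
qed

text \<open>This isolates what the linear homeomorphism contributes to the control of oscillation;
  the arguments up to \<open>sigma_summable_network_on\<close> concern \<open>Y\<close>
  alone.\<close>

definition sigma_summable :: "'a topology \<Rightarrow> ('a \<Rightarrow> real) set \<Rightarrow> bool"
  where "sigma_summable Y F \<longleftrightarrow> (\<forall>f t. range f \<subseteq> F \<and> (\<forall>n::nat. 0 < t n) \<and> summable t \<longrightarrow>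
    (\<exists>g. scatteredly_continuous Y euclideanreal g \<and>
      (\<forall>y\<in>topspace Y. (\<lambda>n. t n * f n y) sums g y)))"

lemma sigma_summableE:
  assumes "sigma_summable Y F" and "\<And>n. f n \<in> F" and "\<And>n::nat. 0 < t n" and "summable t"
  obtains g where "scatteredly_continuous Y euclideanreal g"
    and "\<And>y. y \<in> topspace Y \<Longrightarrow> (\<lambda>n. t n * f n y) sums g y"
proof -
  have "range f \<subseteq> F \<and> (\<forall>n. 0 < t n) \<and> summable t" using assms by blast
  then have "\<exists>g. scatteredly_continuous Y euclideanreal g \<and>
      (\<forall>y\<in>topspace Y. (\<lambda>n. t n * f n y) sums g y)"
    using assms(1)[unfolded sigma_summable_def, rule_format, of f t] by simp
  then show thesis by (metis that)
qed

text \<open>If \<open>f n\<close> exceeded \<open>2 ^ n\<close> in absolute value at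
  \<open>y\<close> for every \<open>n\<close>, the terms of the series with coefficients
  \<open>(1/2) ^ n\<close> would not tend to 0 at \<open>y\<close>.\<close>

lemma sigma_summable_pointwise_bounded:
  assumes F: "sigma_summable Y F" and y: "y \<in> topspace Y"
  shows "\<exists>m::nat. \<forall>f\<in>F. \<bar>f y\<bar> \<le> m"
proof (rule ccontr)
  assume "\<not> ?thesis"
  then have "\<forall>n. \<exists>f\<in>F. 2 ^ n < \<bar>f y\<bar>"
    by (metis not_le of_nat_numeral of_nat_power)
  then obtain f where f: "\<And>n. f n \<in> F" "\<And>n::nat. 2 ^ n < \<bar>f n y\<bar>" by metis
  obtain g where "(\<lambda>n. (1/2) ^ n * f n y) sums g y"
    using sigma_summableE[where f = f and t = "\<lambda>n. (1/2) ^ n", OF F f(1)] y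
    by (auto simp: summable_geometric)
  then have "(\<lambda>n. (1/2) ^ n * f n y) \<longlonglongrightarrow> 0"
    using sums_summable summable_LIMSEQ_zero by blast
  then have "\<forall>\<^sub>F n in sequentially. \<bar>(1/2) ^ n * f n y\<bar> < 1"
    using order_tendstoD(2)[OF tendsto_rabs_zero, of _ _ 1] by simp
  then obtain n where "\<bar>(1/2) ^ n * f n y\<bar> < 1" using eventually_happens' sequentially_bot by blast
  moreover have "\<bar>(1/2) ^ n * f n y\<bar> = \<bar>f n y\<bar> / 2 ^ n" by (simp add: abs_mult power_divide)
  ultimately show False using f(2)[of n] by simp
qed

text \<open>The previous lemmas combine to a contradiction: a series with discontinuities at all
  points of a dense subset \<open>D\<close> of a countable \<open>Q\<close> converges to a function
  that is scatteredly continuous. One \<open>V\<close> serves all of \<open>F\<close>, as the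
  construction of a small controlling family requires.\<close>

lemma sigma_summable_weakly_discontinuous:
  assumes tight: "countably_tight Y" and F: "sigma_summable Y F"
    and A: "A \<subseteq> topspace Y" "A \<noteq> {}" and bound: "\<And>f a. \<lbrakk>f \<in> F; a \<in> A\<rbrakk> \<Longrightarrow> \<bar>f a\<bar> \<le> m"
  shows "\<exists>V. openin Y V \<and> V \<inter> A \<noteq> {} \<and> (\<forall>f\<in>F. \<forall>a\<in>V \<inter> A. cont_at Y A f a)"
proof (rule ccontr)
  assume neg: "\<not> ?thesis"
  have "A \<subseteq> Y closure_of {a\<in>A. \<exists>f\<in>F. \<not> cont_at Y A f a}"
  proof
    fix a assume "a \<in> A"
    then show "a \<in> Y closure_of {a\<in>A. \<exists>f\<in>F. \<not> cont_at Y A f a}"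
      unfolding in_closure_of using A neg by blast
  qed
  from countable_dense_discontinuities[OF tight A this] obtain Q D where
    Q: "countable Q" "Q \<subseteq> A" and D: "D \<subseteq> Q" "D \<noteq> {}" "Q \<subseteq> Y closure_of D"
    and disc: "\<And>q. q \<in> D \<Longrightarrow> \<exists>f\<in>F. \<not> cont_at Y Q f q" by metis
  \<comment> \<open>If \<open>D\<close> is finite, this enumeration repeats points, which is
    harmless.\<close>
  define q where "q = from_nat_into D"
  have "range q = D"
    unfolding q_def using range_from_nat_into D Q countable_subset by metis
  then have "q n \<in> D" for n by blast
  then have "\<exists>f\<in>F. \<not> cont_at Y Q f (q n)" for n using disc by simp
  then obtain f where f: "\<And>n. f n \<in> F" "\<And>n. \<not> cont_at Y Q (f n) (q n)" by metis
  have "q n \<in> Q" for n using \<open>\<And>n. q n \<in> D\<close> D by blast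
  have f_bound: "\<bar>f n x\<bar> \<le> m" if "x \<in> Q" for n x using bound f(1) Q that by blast
  obtain t where t: "\<And>n. 0 < t n" "summable t"
    and gen: "\<And>g n. \<forall>x\<in>Q. (\<lambda>k. t k * f k x) sums g x \<Longrightarrow> \<not> cont_at Y Q g (q n)"
    by (rule exists_series_discontinuous_at_sequence[where f = f, OF f(2) \<open>\<And>n. q n \<in> Q\<close> f_bound])
      (assumption, rule that)
  obtain g where g: "scatteredly_continuous Y euclideanreal g"
    "\<And>y. y \<in> topspace Y \<Longrightarrow> (\<lambda>n. t n * f n y) sums g y"
    by (rule sigma_summableE[where f = f and t = t, OF F f(1) t]) (rule that)
  have "Q \<subseteq> topspace Y" using Q A by blast
  with gen g(2) have "\<not> cont_at Y Q g (q n)" for n by blast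
  then have "D \<subseteq> {x\<in>Q. \<not> cont_at Y Q g x}" using \<open>range q = D\<close> D(1) by blast
  with D(2,3) show False
    using scatteredly_continuous_discontinuities_not_dense[OF g(1) \<open>Q \<subseteq> topspace Y\<close> refl]
      closure_of_mono by blast
qed

section \<open>Families of sets controlling oscillation\<close>

text \<open>At the points of \<open>A\<close> the family acts as a network for the topology induced
  by each single function of \<open>F\<close>; one family has to serve all of them.\<close>

definition network_on :: "'a set \<Rightarrow> ('a \<Rightarrow> real) set \<Rightarrow> 'a set set \<Rightarrow> bool"
  where "network_on A F \<M> \<longleftrightarrow>
    (\<forall>a\<in>A. \<forall>f\<in>F. \<forall>\<epsilon>>0. \<exists>N\<in>\<M>. a \<in> N \<and> (\<forall>x\<in>N. \<bar>f x - f a\<bar> < \<epsilon>))"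

text \<open>A space with an infinite network \<open>\<N>\<close> is hereditarily \<open>|\<N>|\<close>-Lindelof, so there is a largest
  open set on whose trace a small enough family exists.\<close>

lemma weakly_discontinuous_network_on:
  assumes \<N>: "network Y \<N>" "infinite \<N>" and A: "A \<subseteq> topspace Y"
    and wd: "\<And>B. \<lbrakk>B \<subseteq> A; B \<noteq> {}\<rbrakk> \<Longrightarrow>
      \<exists>V. openin Y V \<and> V \<inter> B \<noteq> {} \<and> (\<forall>f\<in>F. \<forall>a\<in>V \<inter> B. cont_at Y B f a)"
  shows "\<exists>\<M>. |\<M>| \<le>o |\<N>| \<and> network_on A F \<M>"
proof -
  define good where "good V \<longleftrightarrow> (\<exists>\<M>. |\<M>| \<le>o |\<N>| \<and> network_on (V \<inter> A) F \<M>)" for V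
  define G where "G = \<Union>{V. openin Y V \<and> good V}"
  have "openin Y G" by (auto simp: G_def)
  have "good G"
  proof -
    \<comment> \<open>These sets cover \<open>G\<close>, and there are at most \<open>|\<N>|\<close>
      of them, so choosing one family for each keeps the union small.\<close>
    define \<N>0 where "\<N>0 = {N\<in>\<N>. \<exists>V. openin Y V \<and> good V \<and> N \<subseteq> V}"
    have "\<exists>\<M>. |\<M>| \<le>o |\<N>| \<and> network_on (N \<inter> A) F \<M>" if N: "N \<in> \<N>0" for N
    proof -
      obtain V \<M> where "N \<subseteq> V" "|\<M>| \<le>o |\<N>|" "network_on (V \<inter> A) F \<M>"
        using N unfolding \<N>0_def good_def by blast
      moreover from this have "network_on (N \<inter> A) F \<M>"
        unfolding network_on_def by (metis IntD1 IntD2 IntI subsetD)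
      ultimately show ?thesis by blast
    qed
    then obtain \<M> where \<M>: "\<And>N. N \<in> \<N>0 \<Longrightarrow> |\<M> N| \<le>o |\<N>|"
      "\<And>N. N \<in> \<N>0 \<Longrightarrow> network_on (N \<inter> A) F (\<M> N)" by metis
    have "| \<Union>N\<in>\<N>0. \<M> N | \<le>o |\<N>|"
      using \<M>(1) by (intro card_of_UNION_ordLeq_infinite[OF \<N>(2)] card_of_mono1) (auto simp: \<N>0_def)
    moreover have "network_on (G \<inter> A) F (\<Union>N\<in>\<N>0. \<M> N)"
      unfolding network_on_def
    proof (intro ballI allI impI)
      fix a f and \<epsilon> :: real assume *: "a \<in> G \<inter> A" "f \<in> F" "0 < \<epsilon>"
      then obtain V where "openin Y V" "good V" "a \<in> V" by (auto simp: G_def)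
      then obtain N where "N \<in> \<N>" "a \<in> N" "N \<subseteq> V" using \<N>(1) unfolding network_def by blast
      then have "N \<in> \<N>0" using \<open>openin Y V\<close> \<open>good V\<close> by (auto simp: \<N>0_def)
      with \<M>(2) * \<open>a \<in> N\<close> have "\<exists>N'\<in>\<M> N. a \<in> N' \<and> (\<forall>x\<in>N'. \<bar>f x - f a\<bar> < \<epsilon>)"
        unfolding network_on_def by (meson IntD2 IntI)
      then show "\<exists>N\<in>\<Union>N\<in>\<N>0. \<M> N. a \<in> N \<and> (\<forall>x\<in>N. \<bar>f x - f a\<bar> < \<epsilon>)"
        using \<open>N \<in> \<N>0\<close> by blast
    qed
    ultimately show ?thesis unfolding good_def by blast
  qed
  have "A \<subseteq> G"
  proof (rule ccontr)
    assume "\<not> A \<subseteq> G"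
    \<comment> \<open>On the part of \<open>A\<close> outside \<open>G\<close> weak discontinuity
      yields an open \<open>V\<close> on which all functions are continuous relative to
      \<open>B\<close>. The traces \<open>N \<inter> B\<close> control them there, so
      \<open>V \<union> G\<close> is good, against the maximality of \<open>G\<close>.\<close>
    define B where "B = A - G"
    with \<open>\<not> A \<subseteq> G\<close> have "B \<subseteq> A" "B \<noteq> {}" by auto
    from wd[OF this] obtain V where V: "openin Y V" "V \<inter> B \<noteq> {}"
      "\<And>f a. \<lbrakk>f \<in> F; a \<in> V \<inter> B\<rbrakk> \<Longrightarrow> cont_at Y B f a"
      by metis
    obtain \<M> where \<M>: "|\<M>| \<le>o |\<N>|" "network_on (G \<inter> A) F \<M>"
      using \<open>good G\<close> unfolding good_def by blast
    have "|\<M> \<union> (\<lambda>N. N \<inter> B) ` \<N>| \<le>o |\<N>|"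
      by (rule card_of_Un_ordLeq_infinite_Field[OF _ \<M>(1) card_of_image card_of_Card_order])
        (unfold Field_card_of, rule \<N>(2))
    moreover have "network_on ((V \<union> G) \<inter> A) F (\<M> \<union> (\<lambda>N. N \<inter> B) ` \<N>)"
      unfolding network_on_def
    proof (intro ballI allI impI)
      fix a f and \<epsilon> :: real assume *: "a \<in> (V \<union> G) \<inter> A" "f \<in> F" "0 < \<epsilon>"
      show "\<exists>N\<in>\<M> \<union> (\<lambda>N. N \<inter> B) ` \<N>. a \<in> N \<and> (\<forall>x\<in>N. \<bar>f x - f a\<bar> < \<epsilon>)"
      proof (cases "a \<in> G")
        case True
        with * have "a \<in> G \<inter> A" by blast
        then have "\<exists>N\<in>\<M>. a \<in> N \<and> (\<forall>x\<in>N. \<bar>f x - f a\<bar> < \<epsilon>)"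
          using \<M>(2) *(2,3) unfolding network_on_def by simp
        then show ?thesis by blast
      next
        case False
        then have a: "a \<in> V \<inter> B" using * by (auto simp: B_def)
        then obtain W where W: "openin Y W" "a \<in> W" "\<And>x. \<lbrakk>x \<in> W; x \<in> B\<rbrakk> \<Longrightarrow> \<bar>f x - f a\<bar> < \<epsilon>"
          using cont_atD[OF V(3)] * by metis
        then obtain N where "N \<in> \<N>" "a \<in> N" "N \<subseteq> W" using \<N>(1) unfolding network_def by blast
        then show ?thesis using W(3) a by (intro bexI[of _ "N \<inter> B"]) auto
      qed
    qed
    ultimately have "good (V \<union> G)" unfolding good_def by blast
    then have "V \<subseteq> G" using \<open>openin Y G\<close> V(1) unfolding G_def by blast
    with V(2) show False by (auto simp: B_def)
  qed
  then have "G \<inter> A = A" by blast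
  with \<open>good G\<close> show ?thesis unfolding good_def by simp
qed

text \<open>The uniform bound required for weak discontinuity holds on each \<open>A m\<close>. By
  pointwise boundedness these countably many pieces exhaust \<open>Y\<close>, and a countable union
  of families stays within the infinite cardinal \<open>|\<N>|\<close>.\<close>

lemma sigma_summable_network_on:
  assumes "countably_tight Y" and F: "sigma_summable Y F" and \<N>: "network Y \<N>" "infinite \<N>"
  shows "\<exists>\<M>. |\<M>| \<le>o |\<N>| \<and> network_on (topspace Y) F \<M>"
proof -
  define A where "A m = {y\<in>topspace Y. \<forall>f\<in>F. \<bar>f y\<bar> \<le> real m}" for m :: nat
  have "\<exists>\<M>. |\<M>| \<le>o |\<N>| \<and> network_on (A m) F \<M>" for m
  proof (rule weakly_discontinuous_network_on[OF \<N>])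
    fix B assume B: "B \<subseteq> A m" "B \<noteq> {}"
    show "\<exists>V. openin Y V \<and> V \<inter> B \<noteq> {} \<and> (\<forall>f\<in>F. \<forall>a\<in>V \<inter> B. cont_at Y B f a)"
      by (rule sigma_summable_weakly_discontinuous[OF assms(1) F, of _ "real m"])
        (use B in \<open>auto simp: A_def\<close>)
  qed (auto simp: A_def)
  then obtain \<M> where \<M>: "\<And>m. |\<M> m| \<le>o |\<N>|" "\<And>m. network_on (A m) F (\<M> m)" by metis
  have "topspace Y = (\<Union>m. A m)"
    using sigma_summable_pointwise_bounded[OF F] by (auto simp: A_def)
  then have "network_on (topspace Y) F (\<Union>m. \<M> m)"
    using \<M>(2) unfolding network_on_def by (metis UN_iff)
  moreover have "| \<Union>m. \<M> m | \<le>o |\<N>|"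
    using \<N>(2) \<M>(1) by (intro card_of_UNION_ordLeq_infinite) (auto simp: infinite_iff_card_of_nat)
  ultimately show ?thesis by blast
qed

section \<open>The linear space of scatteredly continuous functions\<close>

lemma scatteredly_continuous_real_iff:
  "scatteredly_continuous X euclideanreal f \<longleftrightarrow>
    (\<forall>A \<subseteq> topspace X. A \<noteq> {} \<longrightarrow> (\<exists>a\<in>A. cont_at X A f a))"
  unfolding scatteredly_continuous_def using topcontinuous_at_subtopology_real_iff[of _ X _ f]
  by (auto 4 4)

lemma restrict_in_SC_iff:
  "restrict f (topspace X) \<in> SC X \<longleftrightarrow> (\<forall>A \<subseteq> topspace X. A \<noteq> {} \<longrightarrow> (\<exists>a\<in>A. cont_at X A f a))"
proof -
  have "cont_at X A (restrict f (topspace X)) a \<longleftrightarrow> cont_at X A f a"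
    if "A \<subseteq> topspace X" "a \<in> A" for A a
    using that cont_at_cong[of X A f a "restrict f (topspace X)"]
      cont_at_cong[of X A "restrict f (topspace X)" a f] by (auto simp: subset_iff)
  then show ?thesis unfolding SC_def scatteredly_continuous_real_iff by auto
qed

lemma restrict_continuous_map_in_SC:
  assumes "continuous_map X euclideanreal f"
  shows "restrict f (topspace X) \<in> SC X"
  unfolding restrict_in_SC_iff
proof (intro allI impI)
  fix A assume A: "A \<subseteq> topspace X" "A \<noteq> {}"
  then obtain a where "a \<in> A" by blast
  have "continuous_map (subtopology X A) euclideanreal f"
    using assms by (rule continuous_map_from_subtopology)
  then have "topcontinuous_at (subtopology X A) euclideanreal f a"
    using A \<open>a \<in> A\<close> unfolding continuous_map_eq_topcontinuous_at by auto
  then have "cont_at X A f a"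
    using topcontinuous_at_subtopology_real_iff[OF A(1) \<open>a \<in> A\<close>] by simp
  with \<open>a \<in> A\<close> show "\<exists>a\<in>A. cont_at X A f a" by blast
qed

text \<open>Since the discontinuities of \<open>f\<close> on \<open>A\<close> are not dense,
  \<open>f\<close> is continuous on \<open>A\<close> at all points of some nonempty trace
  \<open>V \<inter> A\<close>. A continuity point of \<open>g\<close> on this trace is one on
  \<open>A\<close>, because \<open>V\<close> is open.\<close>

lemma SC_linear_combination:
  assumes f: "f \<in> SC X" and g: "g \<in> SC X"
  shows "(\<lambda>x\<in>topspace X. b * f x + c * g x) \<in> SC X"
  unfolding restrict_in_SC_iff
proof (intro allI impI)
  fix A assume A: "A \<subseteq> topspace X" "A \<noteq> {}"
  define D where "D = {x\<in>A. \<not> cont_at X A f x}"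
  have f: "scatteredly_continuous X euclideanreal f" and
    g: "scatteredly_continuous X euclideanreal g" using f g by (auto simp: SC_def)
  have "\<exists>V. openin X V \<and> V \<inter> A \<noteq> {} \<and> V \<inter> D = {}"
  proof (cases "D = {}")
    case True
    then show ?thesis using A by (intro exI[of _ "topspace X"]) auto
  next
    case False
    then have "\<not> A \<subseteq> X closure_of D"
      using scatteredly_continuous_discontinuities_not_dense[OF f A(1) D_def] by blast
    then show ?thesis unfolding in_closure_of subset_iff using A by blast
  qed
  then obtain V where V: "openin X V" "V \<inter> A \<noteq> {}" "V \<inter> D = {}" by blast
  have "V \<inter> A \<subseteq> topspace X" using A by blast
  then obtain a where a: "a \<in> V \<inter> A" "cont_at X (V \<inter> A) g a"
    using g V(2) unfolding scatteredly_continuous_real_iff by blast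
  have "cont_at X A g a"
    unfolding cont_at_def
  proof (intro allI impI)
    fix \<epsilon> :: real assume "0 < \<epsilon>"
    from cont_atD[OF a(2) this] obtain W where "openin X W" "a \<in> W"
      "\<And>x. \<lbrakk>x \<in> W; x \<in> V \<inter> A\<rbrakk> \<Longrightarrow> \<bar>g x - g a\<bar> < \<epsilon>" by metis
    then show "\<exists>W. openin X W \<and> a \<in> W \<and> (\<forall>x\<in>W \<inter> A. \<bar>g x - g a\<bar> < \<epsilon>)"
      using V(1) a(1) by (intro exI[of _ "W \<inter> V"]) auto
  qed
  moreover have "cont_at X A f a" using a(1) V(3) by (auto simp: D_def)
  ultimately have "cont_at X A (\<lambda>x. b * f x + c * g x) a"
    by (intro cont_at_linear_combination)
  with a(1) show "\<exists>a\<in>A. cont_at X A (\<lambda>x. b * f x + c * g x) a" by blast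
qed

lemma SC_add: "\<lbrakk>f \<in> SC X; g \<in> SC X\<rbrakk> \<Longrightarrow> (\<lambda>x\<in>topspace X. f x + g x) \<in> SC X"
  using SC_linear_combination[of f X g 1 1] by simp

lemma SC_scale: "f \<in> SC X \<Longrightarrow> (\<lambda>x\<in>topspace X. c * f x) \<in> SC X"
  using SC_linear_combination[of f X f c 0] by simp

lemma SC_sum:
  assumes "finite I" and "\<And>i. i \<in> I \<Longrightarrow> \<phi> i \<in> SC X"
  shows "(\<lambda>x\<in>topspace X. \<Sum>i\<in>I. c i * \<phi> i x) \<in> SC X"
  using assms
proof (induction I)
  case empty
  have "(\<lambda>x\<in>topspace X. 0) \<in> SC X" by (rule restrict_continuous_map_in_SC) simp
  then show ?case by (simp only: sum.empty)
next
  case (insert i I)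
  have "(\<lambda>x\<in>topspace X. c i * \<phi> i x + 1 * (\<lambda>x\<in>topspace X. \<Sum>i\<in>I. c i * \<phi> i x) x) \<in> SC X"
    by (rule SC_linear_combination) (use insert in auto)
  moreover have "(\<lambda>x\<in>topspace X. c i * \<phi> i x + 1 * (\<lambda>x\<in>topspace X. \<Sum>i\<in>I. c i * \<phi> i x) x) =
      (\<lambda>x\<in>topspace X. \<Sum>i\<in>insert i I. c i * \<phi> i x)"
    using insert by (intro restrict_ext) auto
  ultimately show ?case by (simp only:)
qed

section \<open>Linear maps and homeomorphisms between spaces of scatteredly continuous
  functions\<close>

lemma SC_linearD:
  assumes "SC_linear X Y T" and "f \<in> SC X"
  shows "g \<in> SC X \<Longrightarrow> T (\<lambda>x\<in>topspace X. f x + g x) = (\<lambda>y\<in>topspace Y. T f y + T g y)"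
    and "T (\<lambda>x\<in>topspace X. c * f x) = (\<lambda>y\<in>topspace Y. c * T f y)"
  using assms by (simp_all add: SC_linear_def)

lemma SC_linear_sum:
  assumes T: "SC_linear X Y T" and "finite I" and "\<And>i. i \<in> I \<Longrightarrow> \<phi> i \<in> SC X"
  shows "T (\<lambda>x\<in>topspace X. \<Sum>i\<in>I. c i * \<phi> i x) = (\<lambda>y\<in>topspace Y. \<Sum>i\<in>I. c i * T (\<phi> i) y)"
  using assms(2,3)
proof (induction I)
  case empty
  have "(\<lambda>x\<in>topspace X. 0) \<in> SC X" by (rule restrict_continuous_map_in_SC) simp
  \<comment> \<open>The value of \<open>T\<close> at the zero function comes from homogeneity with
    the factor 0.\<close>
  then have "T (\<lambda>x\<in>topspace X. 0 * (\<lambda>x\<in>topspace X. 0) x) = (\<lambda>y\<in>topspace Y. 0 * T (\<lambda>x\<in>topspace X. 0) y)"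
    using SC_linearD(2)[OF T] by blast
  then show ?case by (simp only: sum.empty mult_zero_left)
next
  case (insert i I)
  let ?u = "\<lambda>x\<in>topspace X. c i * \<phi> i x" and ?v = "\<lambda>x\<in>topspace X. \<Sum>i\<in>I. c i * \<phi> i x"
  have "?u \<in> SC X" "?v \<in> SC X" using insert by (auto intro: SC_scale SC_sum)
  then have add: "T (\<lambda>x\<in>topspace X. ?u x + ?v x) = (\<lambda>y\<in>topspace Y. T ?u y + T ?v y)"
    using SC_linearD(1)[OF T] by blast
  have scale: "T ?u = (\<lambda>y\<in>topspace Y. c i * T (\<phi> i) y)"
    using SC_linearD(2)[OF T, of "\<phi> i"] insert by blast
  have IH: "T ?v = (\<lambda>y\<in>topspace Y. \<Sum>i\<in>I. c i * T (\<phi> i) y)"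
    using insert.IH insert.prems by blast
  have "T (\<lambda>x\<in>topspace X. \<Sum>i\<in>insert i I. c i * \<phi> i x) = T (\<lambda>x\<in>topspace X. ?u x + ?v x)"
    using insert by (intro arg_cong[of _ _ T] restrict_ext) auto
  also have "\<dots> = (\<lambda>y\<in>topspace Y. \<Sum>i\<in>insert i I. c i * T (\<phi> i) y)"
    unfolding add scale IH using insert by (intro restrict_ext) auto
  finally show ?case .
qed

lemma SC_p_linearly_homeomorphic_sym:
  assumes "SC_p_linearly_homeomorphic X Y"
  shows "SC_p_linearly_homeomorphic Y X"
proof -
  obtain T where T: "homeomorphic_map (SC_p X) (SC_p Y) T" and lin: "SC_linear X Y T"
    using assms unfolding SC_p_linearly_homeomorphic_def by blast
  then obtain S where S: "homeomorphic_maps (SC_p X) (SC_p Y) T S"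
    unfolding homeomorphic_map_maps by blast
  have ST: "S (T f) = f" if "f \<in> SC X" for f
    using S that unfolding homeomorphic_maps_def topspace_SC_p by blast
  have TS: "S g \<in> SC X \<and> T (S g) = g" if "g \<in> SC Y" for g
  proof -
    have "S \<in> SC Y \<rightarrow> SC X" "\<forall>g\<in>SC Y. T (S g) = g"
      using S continuous_map_funspace[of "SC_p Y" "SC_p X" S]
      unfolding homeomorphic_maps_def topspace_SC_p by blast+
    with that show ?thesis by blast
  qed
  have "homeomorphic_map (SC_p Y) (SC_p X) S"
    using S homeomorphic_maps_sym homeomorphic_map_maps by blast
  moreover have "SC_linear Y X S"
    unfolding SC_linear_def
  proof (intro conjI ballI allI)
    fix f g assume f: "f \<in> SC Y" and g: "g \<in> SC Y"
    have "T (\<lambda>x\<in>topspace X. S f x + S g x) = (\<lambda>y\<in>topspace Y. T (S f) y + T (S g) y)"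
      using SC_linearD(1)[OF lin] TS[OF f] TS[OF g] by blast
    with TS[OF f] TS[OF g] show "S (\<lambda>y\<in>topspace Y. f y + g y) = (\<lambda>x\<in>topspace X. S f x + S g x)"
      using ST[OF SC_add[of "S f" X "S g"]] by simp
  next
    fix c f assume f: "f \<in> SC Y"
    have "T (\<lambda>x\<in>topspace X. c * S f x) = (\<lambda>y\<in>topspace Y. c * T (S f) y)"
      using SC_linearD(2)[OF lin] TS[OF f] by blast
    with TS[OF f] show "S (\<lambda>y\<in>topspace Y. c * f y) = (\<lambda>x\<in>topspace X. c * S f x)"
      using ST[OF SC_scale[of "S f" X c]] by simp
  qed
  ultimately show ?thesis unfolding SC_p_linearly_homeomorphic_def by blast
qed

lemma homeomorphic_map_SC_p:
  assumes "homeomorphic_map (SC_p X) (SC_p Y) T"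
  shows "f \<in> SC X \<Longrightarrow> T f \<in> SC Y" and "inj_on T (SC X)"
  using assms unfolding homeomorphic_eq_everything_map topspace_SC_p by blast+

text \<open>By the Weierstrass test the series of preimages converges uniformly to a continuous
  function, hence in \<open>SC_p X\<close>. Continuity and linearity of \<open>T\<close> carry the
  partial sums and their limit over to \<open>Y\<close>.\<close>

lemma sigma_summable_image_unit_ball:
  fixes X :: "'a topology" and Y :: "'b topology"
  assumes T: "homeomorphic_map (SC_p X) (SC_p Y) T" and lin: "SC_linear X Y T"
  shows "sigma_summable Y
    (T ` {\<phi>\<in>SC X. continuous_map X euclideanreal \<phi> \<and> (\<forall>x\<in>topspace X. \<bar>\<phi> x\<bar> \<le> 1)})"
    (is "sigma_summable Y (T ` ?C)")
  unfolding sigma_summable_def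
proof (intro allI impI)
  fix f :: "nat \<Rightarrow> 'b \<Rightarrow> real" and t :: "nat \<Rightarrow> real"
  assume *: "range f \<subseteq> T ` ?C \<and> (\<forall>n. 0 < t n) \<and> summable t"
  define \<phi> where "\<phi> n = inv_into ?C T (f n)" for n
  have "f n \<in> T ` ?C" for n using * by auto
  then have \<phi>: "\<phi> n \<in> ?C" "f n = T (\<phi> n)" for n
    unfolding \<phi>_def using inv_into_into[of "f n" T ?C] f_inv_into_f[of "f n" T ?C] by simp_all
  define s where "s N = (\<lambda>x\<in>topspace X. \<Sum>n<N. t n * \<phi> n x)" for N
  define \<Phi> where "\<Phi> x = (\<Sum>n. t n * \<phi> n x)" for x
  have unif: "uniform_limit (topspace X) (\<lambda>N x. \<Sum>n<N. t n * \<phi> n x) \<Phi> sequentially"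
    unfolding \<Phi>_def
  proof (rule Weierstrass_m_test)
    show "norm (t n * \<phi> n x) \<le> t n" if "x \<in> topspace X" for n x
      using \<phi>(1)[of n] * that mult_left_mono[of "\<bar>\<phi> n x\<bar>" 1 "t n"]
      by (auto simp: abs_mult less_imp_le)
  qed (use * in auto)
  have "continuous_map X euclideanreal \<Phi>"
    unfolding mtopology_is_euclidean[symmetric]
  proof (rule Met_TC.continuous_map_uniform_limit)
    show "\<forall>\<^sub>F N in sequentially. continuous_map X Met_TC.mtopology (\<lambda>x. \<Sum>n<N. t n * \<phi> n x)"
    proof (intro always_eventually allI)
      fix N
      show "continuous_map X Met_TC.mtopology (\<lambda>x. \<Sum>n<N. t n * \<phi> n x)"
        unfolding mtopology_is_euclidean
        by (intro continuous_map_sum continuous_map_real_mult_left) (use \<phi>(1) in auto)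
    qed
    show "\<forall>\<^sub>F N in sequentially. \<forall>x\<in>topspace X. \<Phi> x \<in> UNIV \<and> dist (\<Sum>n<N. t n * \<phi> n x) (\<Phi> x) < \<epsilon>"
      if "0 < \<epsilon>" for \<epsilon>
      using uniform_limitD[OF unif that] by simp
  qed simp
  then have \<Phi>: "restrict \<Phi> (topspace X) \<in> SC X" by (rule restrict_continuous_map_in_SC)
  have s_SC: "s N \<in> SC X" for N unfolding s_def using \<phi>(1) by (intro SC_sum) auto
  have "limitin (SC_p X) s (restrict \<Phi> (topspace X)) sequentially"
    unfolding SC_p_def limitin_subtopology limitin_componentwise
  proof (intro conjI ballI)
    fix x assume x: "x \<in> topspace X"
    have "(\<lambda>N. \<Sum>n<N. t n * \<phi> n x) \<longlonglongrightarrow> \<Phi> x"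
      using tendsto_uniform_limitI[OF unif x] .
    then show "limitin euclideanreal (\<lambda>N. s N x) (restrict \<Phi> (topspace X) x) sequentially"
      using x by (simp add: s_def)
  qed (use \<Phi> s_SC in \<open>auto simp: SC_def PiE_def\<close>)
  then have lim: "limitin (SC_p Y) (T \<circ> s) (T (restrict \<Phi> (topspace X))) sequentially"
    by (rule continuous_map_limit[OF homeomorphic_imp_continuous_map[OF T]])
  show "\<exists>g. scatteredly_continuous Y euclideanreal g \<and>
      (\<forall>y\<in>topspace Y. (\<lambda>n. t n * f n y) sums g y)"
  proof (intro exI conjI ballI)
    show "scatteredly_continuous Y euclideanreal (T (restrict \<Phi> (topspace X)))"
      using homeomorphic_map_SC_p(1)[OF T \<Phi>] by (simp add: SC_def)
    fix y assume y: "y \<in> topspace Y"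
    have "(\<lambda>N. T (s N) y) \<longlonglongrightarrow> T (restrict \<Phi> (topspace X)) y"
      using lim y unfolding SC_p_def limitin_subtopology limitin_componentwise by simp
    moreover have "T (s N) y = (\<Sum>n<N. t n * f n y)" for N
      unfolding s_def using SC_linear_sum[OF lin, of "{..<N}" \<phi> t] \<phi> y by simp
    ultimately show "(\<lambda>n. t n * f n y) sums T (restrict \<Phi> (topspace X)) y"
      by (simp add: sums_def)
  qed
qed

section \<open>Comparison of networks\<close>

text \<open>Sets of \<open>n + 1\<close> elements arise by inserting a point into sets of
  \<open>n\<close> elements, so each size contributes at most \<open>|A|\<close> sets, and there are
  countably many sizes.\<close>

lemma card_of_Fpow_ordLeq:
  assumes "infinite A"
  shows "|Fpow A| \<le>o |A|"
proof -
  define P where "P n = {S. S \<subseteq> A \<and> finite S \<and> card S = n}" for n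
  have "|P n| \<le>o |A|" for n
  proof (induction n)
    case 0
    have "P 0 = {{}}" by (auto simp: P_def)
    moreover have "A \<noteq> {}" using assms by auto
    ultimately show ?case by (simp add: card_of_singl_ordLeq)
  next
    case (Suc n)
    have "P (Suc n) \<subseteq> (\<lambda>(a, S). insert a S) ` (A \<times> P n)"
    proof
      fix S assume "S \<in> P (Suc n)"
      then obtain a R where "S = insert a R" "a \<notin> R" "card R = n" "finite R" "S \<subseteq> A"
        unfolding P_def by (auto simp: card_Suc_eq)
      then show "S \<in> (\<lambda>(a, S). insert a S) ` (A \<times> P n)" by (auto simp: P_def)
    qed
    then have "|P (Suc n)| \<le>o |A \<times> P n|" by (rule surj_imp_ordLeq)
    also have "|A \<times> P n| \<le>o |A|"
      using card_of_Times_ordLeq_infinite_Field[of "|A|" A "P n"] assms Suc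
      by (simp add: Field_card_of card_of_card_order_on card_of_mono1)
    finally show ?case .
  qed
  moreover have "Fpow A = (\<Union>n. P n)" by (auto simp: Fpow_def P_def)
  ultimately show ?thesis
    using assms card_of_UNION_ordLeq_infinite[of A "UNIV :: nat set" P]
    by (simp add: infinite_iff_card_of_nat)
qed

lemma open_SC_p_contains_box:
  assumes "openin (SC_p Y) W" and "f \<in> W"
  obtains E \<epsilon> where "finite E" and "E \<subseteq> topspace Y" and "0 < (\<epsilon> :: real)"
    and "\<And>g. \<lbrakk>g \<in> SC Y; \<forall>y\<in>E. \<bar>g y - f y\<bar> < \<epsilon>\<rbrakk> \<Longrightarrow> g \<in> W"
proof -
  obtain O' where O': "openin (powertop_real (topspace Y)) O'" "W = O' \<inter> SC Y"
    using assms(1) unfolding SC_p_def openin_subtopology by blast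
  then have "f \<in> O'" using assms(2) by simp
  from product_topology_open_contains_basis[OF O'(1) this] obtain B where
    B: "f \<in> (\<Pi>\<^sub>E i\<in>topspace Y. B i)" "\<forall>i. openin euclideanreal (B i)"
      "finite {i. B i \<noteq> topspace euclideanreal}" "(\<Pi>\<^sub>E i\<in>topspace Y. B i) \<subseteq> O'" by blast
  define E where "E = {y \<in> topspace Y. B y \<noteq> UNIV}"
  have "finite E" using B(3) by (simp add: E_def)
  have "\<exists>\<epsilon>>0. \<forall>u. \<bar>u - f y\<bar> < \<epsilon> \<longrightarrow> u \<in> B y" if "y \<in> E" for y
  proof -
    have "open (B y)" "f y \<in> B y" using B(1,2) that by (auto simp: E_def)
    then show ?thesis by (metis dist_real_def open_dist)
  qed
  then obtain e where e: "\<And>y. y \<in> E \<Longrightarrow> 0 < e y"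
    "\<And>y u. \<lbrakk>y \<in> E; \<bar>u - f y\<bar> < e y\<rbrakk> \<Longrightarrow> u \<in> B y" by metis
  \<comment> \<open>The inserted 1 keeps the minimum meaningful when \<open>E\<close> is
    empty.\<close>
  define \<epsilon> where "\<epsilon> = Min (insert 1 (e ` E))"
  have \<epsilon>: "0 < \<epsilon>" "\<And>y. y \<in> E \<Longrightarrow> \<epsilon> \<le> e y"
    using \<open>finite E\<close> e(1) by (auto simp: \<epsilon>_def)
  have "g \<in> W" if g: "g \<in> SC Y" "\<forall>y\<in>E. \<bar>g y - f y\<bar> < \<epsilon>" for g
  proof -
    have "g y \<in> B y" if "y \<in> topspace Y" for y
    proof (cases "y \<in> E")
      case True
      have "\<bar>g y - f y\<bar> < e y" using bspec[OF g(2) True] \<epsilon>(2)[OF True] by linarith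
      then show ?thesis by (rule e(2)[OF True])
    next
      case False
      then show ?thesis using that by (simp add: E_def)
    qed
    then have "g \<in> (\<Pi>\<^sub>E i\<in>topspace Y. B i)"
      using g(1) by (auto simp: SC_def PiE_iff)
    then show ?thesis using B(4) O'(2) g(1) by blast
  qed
  with \<open>finite E\<close> \<epsilon>(1) show thesis by (intro that[of E \<epsilon>]) (auto simp: E_def)
qed

text \<open>Complete regularity yields a function that is 0 at \<open>x\<close> and 1 off
  \<open>U\<close>; \<open>1 - h\<close> exchanges these values, so that being above 1/2 forces a
  point into \<open>U\<close>.\<close>

lemma Tychonoff_space_separating_function:
  assumes "Tychonoff_space X" and "openin X U" and "x \<in> U"
  obtains \<phi> where "\<phi> \<in> SC X" and "continuous_map X euclideanreal \<phi>"
    and "\<And>z. z \<in> topspace X \<Longrightarrow> \<bar>\<phi> z\<bar> \<le> 1" and "\<phi> x = 1"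
    and "\<And>z. z \<in> topspace X - U \<Longrightarrow> \<phi> z = 0"
proof -
  have "closedin X (topspace X - U)" "x \<in> topspace X - (topspace X - U)"
    using assms openin_subset by (auto intro: closedin_diff)
  then obtain h where h: "continuous_map X (top_of_set {0..1::real}) h" "h x = 0"
    "h ` (topspace X - U) \<subseteq> {1}"
    using assms(1) unfolding Tychonoff_space_def completely_regular_space_def by blast
  then have "continuous_map X euclideanreal h" and h01: "\<And>z. z \<in> topspace X \<Longrightarrow> h z \<in> {0..1}"
    by (auto simp: continuous_map_in_subtopology)
  then have c: "continuous_map X euclideanreal (\<lambda>z. 1 - h z)"
    by (intro continuous_intros) auto
  define \<phi> where "\<phi> = (\<lambda>z\<in>topspace X. 1 - h z)"
  have "x \<in> topspace X" using assms openin_subset by blast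
  show thesis
  proof (rule that[of \<phi>])
    show "\<phi> \<in> SC X" unfolding \<phi>_def by (rule restrict_continuous_map_in_SC[OF c])
    show "continuous_map X euclideanreal \<phi>"
      using c by (rule continuous_map_eq) (simp add: \<phi>_def)
    show "\<bar>\<phi> z\<bar> \<le> 1" if "z \<in> topspace X" for z using h01[OF that] that by (simp add: \<phi>_def)
    show "\<phi> x = 1" using h(2) \<open>x \<in> topspace X\<close> by (simp add: \<phi>_def)
    show "\<phi> z = 0" if "z \<in> topspace X - U" for z using h(3) that by (auto simp: \<phi>_def)
  qed
qed

text \<open>Whether \<open>g x\<close> exceeds 1/2 near a given function is decided by finitely many
  approximate values of \<open>T g\<close>. The controlling family replaces the points of
  \<open>Y\<close> where these are taken by few sets, so few finite lists of conditions suffice to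
  index a network of \<open>X\<close>.\<close>

lemma infinite_network_transfer:
  assumes X: "Tychonoff_space X" and Y: "countably_tight Y"
    and iso: "SC_p_linearly_homeomorphic X Y" and \<N>: "network Y \<N>" "infinite \<N>"
  shows "\<exists>\<K>. network X \<K> \<and> |\<K>| \<le>o |\<N>|"
proof -
  obtain T where T: "homeomorphic_map (SC_p X) (SC_p Y) T" and lin: "SC_linear X Y T"
    using iso unfolding SC_p_linearly_homeomorphic_def by blast
  define C where "C = {\<phi>\<in>SC X. continuous_map X euclideanreal \<phi> \<and> (\<forall>x\<in>topspace X. \<bar>\<phi> x\<bar> \<le> 1)}"
  have "sigma_summable Y (T ` C)"
    unfolding C_def by (rule sigma_summable_image_unit_ball[OF T lin])
  from sigma_summable_network_on[OF Y this \<N>] obtain \<M>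
    where \<M>: "|\<M>| \<le>o |\<N>|" "network_on (topspace Y) (T ` C) \<M>" by blast
  \<comment> \<open>An element \<open>(N, a, b)\<close> encodes the condition that
    \<open>T g\<close> maps \<open>N\<close> into the interval from \<open>a\<close> to
    \<open>b\<close>. Joining \<open>\<N>\<close> keeps \<open>J\<close> infinite however small
    \<open>\<M>\<close> is.\<close>
  define J where "J = (\<M> \<union> \<N>) \<times> (UNIV :: (rat \<times> rat) set)"
  have "infinite J" using \<N>(2) by (auto simp: J_def finite_cartesian_product_iff)
  have "|J| \<le>o |\<N>|"
    unfolding J_def
  proof (rule card_of_Times_ordLeq_infinite_Field)
    show "|\<M> \<union> \<N>| \<le>o |\<N>|"
      by (rule card_of_Un_ordLeq_infinite_Field[OF _ \<M>(1) _ card_of_Card_order])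
        (use \<N>(2) in \<open>simp_all add: Field_card_of card_of_mono1\<close>)
    have "|UNIV :: (rat \<times> rat) set| \<le>o |UNIV :: nat set|"
      using countableI_type[of "UNIV :: (rat \<times> rat) set"]
      unfolding countable_def by (simp add: card_of_ordLeq[symmetric] ex_in_conv)
    also have "|UNIV :: nat set| \<le>o |\<N>|" using \<N>(2) infinite_iff_card_of_nat by blast
    finally show "|UNIV :: (rat \<times> rat) set| \<le>o |\<N>|" .
  qed (use \<N>(2) in \<open>simp_all add: Field_card_of card_of_card_order_on\<close>)
  define box where "box S g \<longleftrightarrow> (\<forall>(N, a, b)\<in>S. \<forall>z\<in>N. real_of_rat a < T g z \<and> T g z < real_of_rat b)"
    for S g
  define K where "K S = {x\<in>topspace X. \<forall>g\<in>C. box S g \<longrightarrow> 1/2 < g x}" for S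
  have "|K ` Fpow J| \<le>o |Fpow J|" by (rule card_of_image)
  also have "|Fpow J| \<le>o |J|" using \<open>infinite J\<close> by (rule card_of_Fpow_ordLeq)
  also note \<open>|J| \<le>o |\<N>|\<close>
  finally have "|K ` Fpow J| \<le>o |\<N>|" .
  moreover have "network X (K ` Fpow J)"
    unfolding network_def
  proof (intro conjI allI impI)
    show "K ` Fpow J \<subseteq> Pow (topspace X)" by (auto simp: K_def)
    fix U x assume U: "openin X U \<and> x \<in> U"
    then have x: "x \<in> topspace X" using openin_subset by blast
    obtain \<phi> where \<phi>: "\<phi> \<in> C" "\<phi> x = 1" "\<And>z. z \<in> topspace X - U \<Longrightarrow> \<phi> z = 0"
    proof (rule Tychonoff_space_separating_function[OF X conjunct1[OF U] conjunct2[OF U]])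
      fix \<phi> assume "\<phi> \<in> SC X" "continuous_map X euclideanreal \<phi>"
        "\<And>z. z \<in> topspace X \<Longrightarrow> \<bar>\<phi> z\<bar> \<le> 1" "\<phi> x = 1" "\<And>z. z \<in> topspace X - U \<Longrightarrow> \<phi> z = 0"
      then show thesis by (intro that[of \<phi>]) (simp_all add: C_def)
    qed
    define W where "W = {g\<in>SC X. 1/2 < g x}"
    have "continuous_map (SC_p X) euclideanreal (\<lambda>g. g x)"
      unfolding SC_p_def using x
      by (intro continuous_map_from_subtopology continuous_map_product_coordinates)
    then have "openin (SC_p X) {g\<in>topspace (SC_p X). g x \<in> {1/2<..}}"
      by (rule openin_continuous_map_preimage) auto
    then have "openin (SC_p X) W" by (simp add: W_def topspace_SC_p)
    then have "openin (SC_p Y) (T ` W)"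
      using homeomorphic_imp_open_map[OF T] unfolding open_map_def by blast
    moreover have "T \<phi> \<in> T ` W" using \<phi> by (auto simp: W_def C_def)
    ultimately obtain E \<epsilon> where E: "finite E" "E \<subseteq> topspace Y" "0 < (\<epsilon> :: real)"
      "\<And>g. \<lbrakk>g \<in> SC Y; \<forall>y\<in>E. \<bar>g y - T \<phi> y\<bar> < \<epsilon>\<rbrakk> \<Longrightarrow> g \<in> T ` W"
      by (rule open_SC_p_contains_box) (rule that)
    have "\<exists>N a b. (N, a, b) \<in> J \<and> y \<in> N \<and> (\<forall>z\<in>N. real_of_rat a < T \<phi> z \<and> T \<phi> z < real_of_rat b)
        \<and> T \<phi> y - \<epsilon> < real_of_rat a \<and> real_of_rat b < T \<phi> y + \<epsilon>" if "y \<in> E" for y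
    proof -
      have "y \<in> topspace Y" "T \<phi> \<in> T ` C" "0 < \<epsilon>/2" using that E \<phi>(1) by auto
      then obtain N where N: "N \<in> \<M>" "y \<in> N" "\<forall>z\<in>N. \<bar>T \<phi> z - T \<phi> y\<bar> < \<epsilon>/2"
        using \<M>(2) unfolding network_on_def by metis
      obtain a where a: "T \<phi> y - \<epsilon> < real_of_rat a" "real_of_rat a < T \<phi> y - \<epsilon>/2"
        using of_rat_dense[of "T \<phi> y - \<epsilon>" "T \<phi> y - \<epsilon>/2"] E(3) by auto
      obtain b where b: "T \<phi> y + \<epsilon>/2 < real_of_rat b" "real_of_rat b < T \<phi> y + \<epsilon>"
        using of_rat_dense[of "T \<phi> y + \<epsilon>/2" "T \<phi> y + \<epsilon>"] E(3) by auto
      have "real_of_rat a < T \<phi> z \<and> T \<phi> z < real_of_rat b" if "z \<in> N" for z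
        using bspec[OF N(3) that] a(2) b(1) by linarith
      then show ?thesis using N a b by (intro exI[of _ N] exI[of _ a] exI[of _ b]) (auto simp: J_def)
    qed
    then obtain N a b where Nab: "\<And>y. y \<in> E \<Longrightarrow> (N y, a y, b y) \<in> J" "\<And>y. y \<in> E \<Longrightarrow> y \<in> N y"
      "\<And>y z. \<lbrakk>y \<in> E; z \<in> N y\<rbrakk> \<Longrightarrow> real_of_rat (a y) < T \<phi> z \<and> T \<phi> z < real_of_rat (b y)"
      "\<And>y. y \<in> E \<Longrightarrow> T \<phi> y - \<epsilon> < real_of_rat (a y) \<and> real_of_rat (b y) < T \<phi> y + \<epsilon>"
      by metis
    define S where "S = (\<lambda>y. (N y, a y, b y)) ` E"
    have "S \<in> Fpow J" using Nab(1) E(1) by (auto simp: S_def Fpow_def)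
    moreover have "x \<in> K S"
      unfolding K_def
    proof (intro CollectI conjI ballI impI)
      fix g assume g: "g \<in> C" "box S g"
      then have "g \<in> SC X" by (simp add: C_def)
      have "\<bar>T g y - T \<phi> y\<bar> < \<epsilon>" if "y \<in> E" for y
      proof -
        have "real_of_rat (a y) < T g y \<and> T g y < real_of_rat (b y)"
          using g(2) Nab(2)[OF that] that by (auto simp: box_def S_def)
        with Nab(4)[OF that] show ?thesis by linarith
      qed
      then have "T g \<in> T ` W" using E(4) homeomorphic_map_SC_p(1)[OF T \<open>g \<in> SC X\<close>] by blast
      then have "g \<in> W"
        using inj_onD[OF homeomorphic_map_SC_p(2)[OF T]] \<open>g \<in> SC X\<close> unfolding W_def by blast
      then show "1/2 < g x" by (simp add: W_def)
    qed (rule x)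
    moreover have "K S \<subseteq> U"
    proof
      \<comment> \<open>Since \<open>\<phi>\<close> itself satisfies the conditions in
        \<open>S\<close>, it exceeds 1/2 at \<open>z\<close>, whereas it vanishes off
        \<open>U\<close>.\<close>
      fix z assume z: "z \<in> K S"
      have "box S \<phi>" using Nab(3) by (auto simp: box_def S_def)
      then have "1/2 < \<phi> z" "z \<in> topspace X" using z \<phi>(1) by (auto simp: K_def)
      then show "z \<in> U" using \<phi>(3)[of z] by auto
    qed
    ultimately show "\<exists>N\<in>K ` Fpow J. x \<in> N \<and> N \<subseteq> U" by blast
  qed
  ultimately show ?thesis by blast
qed

section \<open>Finite spaces\<close>

text \<open>Gaussian elimination: an equation with zero coefficients is dropped, any other one is
  used to eliminate one unknown.\<close>

lemma underdetermined_homogeneous_system: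
  fixes m :: "'i \<Rightarrow> 'j \<Rightarrow> real"
  assumes "finite I" and "finite J" and "card I < card J"
  shows "\<exists>c. (\<exists>j\<in>J. c j \<noteq> 0) \<and> (\<forall>i\<in>I. (\<Sum>j\<in>J. c j * m i j) = 0)"
  using assms
proof (induction I arbitrary: J m)
  case empty
  then obtain j where "j \<in> J" by fastforce
  then show ?case by (intro exI[of _ "\<lambda>_. 1"]) auto
next
  case (insert i I)
  show ?case
  proof (cases "\<exists>p\<in>J. m i p \<noteq> 0")
    case False
    have "card I < card J" using insert by simp
    from insert.IH[OF insert.prems(1) this, of m] obtain c where
      "\<exists>j\<in>J. c j \<noteq> 0" "\<forall>i\<in>I. (\<Sum>j\<in>J. c j * m i j) = 0" by blast
    with False show ?thesis by (intro exI[of _ c]) auto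
  next
    case True
    then obtain p where p: "p \<in> J" "m i p \<noteq> 0" by blast
    define m' where "m' k j = m k j - m k p * m i j / m i p" for k j
    have "card I < card (J - {p})" "finite (J - {p})" using insert p by auto
    from insert.IH[OF this(2,1), of m'] obtain c where
      c: "\<exists>j\<in>J - {p}. c j \<noteq> 0" "\<forall>k\<in>I. (\<Sum>j\<in>J - {p}. c j * m' k j) = 0" by blast
    define s where "s = (\<Sum>j\<in>J - {p}. c j * m i j)"
    \<comment> \<open>The solution of the reduced system is extended by the value at the pivot
      \<open>p\<close> that solves equation \<open>i\<close>.\<close>
    define d where "d j = (if j = p then - s / m i p else c j)" for j
    have split: "(\<Sum>j\<in>J. d j * m k j) = (\<Sum>j\<in>J - {p}. c j * m k j) - s / m i p * m k p" for k
      using insert.prems(1) p(1) by (simp add: sum.remove[of J p] d_def)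
    have "(\<Sum>j\<in>J. d j * m k j) = 0" if "k \<in> insert i I" for k
    proof (cases "k = i")
      case True
      then show ?thesis using p by (simp add: split s_def)
    next
      case False
      then have "0 = (\<Sum>j\<in>J - {p}. c j * m' k j)" using c(2) that by auto
      also have "\<dots> = (\<Sum>j\<in>J - {p}. c j * m k j - (c j * m i j) * (m k p / m i p))"
        by (intro sum.cong) (auto simp: m'_def algebra_simps)
      also have "\<dots> = (\<Sum>j\<in>J - {p}. c j * m k j) - s * (m k p / m i p)"
        unfolding s_def sum_distrib_right by (rule sum_subtractf)
      finally show ?thesis by (simp add: split)
    qed
    moreover have "\<exists>j\<in>J. d j \<noteq> 0" using c(1) by (auto simp: d_def)
    ultimately show ?thesis by blast
  qed
qed

text \<open>If \<open>A\<close> lies in \<open>J\<close>, then the chosen \<open>a\<close> is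
  isolated in \<open>A\<close>; otherwise \<open>a\<close> is taken outside \<open>J\<close>, and
  \<open>f\<close> vanishes on the part of \<open>A\<close> outside the closed finite set
  \<open>J\<close>.\<close>

lemma finite_support_in_SC:
  assumes "t1_space X" and J: "finite J" "J \<subseteq> topspace X"
    and zero: "\<And>x. x \<in> topspace X - J \<Longrightarrow> f x = 0"
  shows "restrict f (topspace X) \<in> SC X"
  unfolding restrict_in_SC_iff
proof (intro allI impI)
  fix A assume A: "A \<subseteq> topspace X" "A \<noteq> {}"
  then obtain a where a: "a \<in> A" "A \<subseteq> J \<or> a \<notin> J" by blast
  define V where "V = topspace X - (J - {a})"
  have "closedin X (J - {a})" using assms unfolding t1_space_closedin_finite by blast
  then have "openin X V" "a \<in> V" using a A by (auto simp: V_def)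
  moreover have "f x = f a" if "x \<in> V \<inter> A" for x
    using that a A zero by (auto simp: V_def)
  ultimately have "cont_at X A f a" unfolding cont_at_def by auto
  with a(1) show "\<exists>a\<in>A. cont_at X A f a" by blast
qed

text \<open>The indicators of more than \<open>card (topspace Y)\<close> points would have linearly
  dependent images under \<open>T\<close>, hence be dependent themselves, as \<open>T\<close> is
  linear and injective.\<close>

lemma finite_SC_p_linearly_homeomorphic_card_le:
  assumes "t1_space X" and iso: "SC_p_linearly_homeomorphic X Y"
    and fin: "finite (topspace Y)"
  shows "finite (topspace X) \<and> card (topspace X) \<le> card (topspace Y)"
proof -
  obtain T where T: "homeomorphic_map (SC_p X) (SC_p Y) T" and lin: "SC_linear X Y T"
    using iso unfolding SC_p_linearly_homeomorphic_def by blast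
  have "card J \<le> card (topspace Y)" if J: "finite J" "J \<subseteq> topspace X" for J
  proof (rule ccontr)
    assume "\<not> ?thesis"
    then have less: "card (topspace Y) < card J" by simp
    define e where "e j = (\<lambda>x\<in>topspace X. if x = j then 1 else 0 :: real)" for j
    have e: "e j \<in> SC X" if "j \<in> J" for j
      unfolding e_def using that J by (intro finite_support_in_SC[OF assms(1), of "{j}"]) auto
    obtain c where c: "\<exists>j\<in>J. c j \<noteq> 0" "\<forall>y\<in>topspace Y. (\<Sum>j\<in>J. c j * T (e j) y) = 0"
      using underdetermined_homogeneous_system[OF fin J(1) less, of "\<lambda>y j. T (e j) y"] by blast
    have lincomb: "T (\<lambda>x\<in>topspace X. \<Sum>j\<in>J. b j * e j x) = (\<lambda>y\<in>topspace Y. \<Sum>j\<in>J. b j * T (e j) y)"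
      "(\<lambda>x\<in>topspace X. \<Sum>j\<in>J. b j * e j x) \<in> SC X" for b
      using SC_linear_sum[OF lin J(1), of e b] SC_sum[OF J(1), of e X b] e by blast+
    \<comment> \<open>Zero is written as a combination with zero coefficients, so that
      \<open>lincomb\<close> covers both sides.\<close>
    have "T (\<lambda>x\<in>topspace X. \<Sum>j\<in>J. c j * e j x) = T (\<lambda>x\<in>topspace X. \<Sum>j\<in>J. 0 * e j x)"
      unfolding lincomb(1) using c(2) by (intro restrict_ext) simp
    then have eq: "(\<lambda>x\<in>topspace X. \<Sum>j\<in>J. c j * e j x) = (\<lambda>x\<in>topspace X. \<Sum>j\<in>J. 0 * e j x)"
      by (rule inj_onD[OF homeomorphic_map_SC_p(2)[OF T] _ lincomb(2) lincomb(2)])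
    have "c i = 0" if "i \<in> J" for i
    proof -
      have i: "i \<in> topspace X" using that J by blast
      then have "(\<Sum>j\<in>J. c j * e j i) = 0" using fun_cong[OF eq, of i] by simp
      moreover have "(\<Sum>j\<in>J. c j * e j i) = (\<Sum>j\<in>J. if i = j then c j else 0)"
        using i by (intro sum.cong) (auto simp: e_def)
      ultimately show ?thesis using J(1) that by (simp add: sum.delta)
    qed
    with c(1) show False by blast
  qed
  then show ?thesis
    by (intro finite_if_finite_subsets_card_bdd) blast
qed

text \<open>In a T1 space a point is determined by the members of a network containing it, so the
  space is finite, hence discrete, and every singleton belongs to the network.\<close>

lemma finite_network_card_le:
  assumes t1: "t1_space Y" and \<N>: "network Y \<N>" "finite \<N>"
  shows "finite (topspace Y) \<and> card (topspace Y) \<le> card \<N>"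
proof -
  have "inj_on (\<lambda>y. {N\<in>\<N>. y \<in> N}) (topspace Y)"
  proof (rule inj_onI, rule ccontr)
    fix y z assume yz: "y \<in> topspace Y" "z \<in> topspace Y"
      and eq: "{N\<in>\<N>. y \<in> N} = {N\<in>\<N>. z \<in> N}" and "y \<noteq> z"
    then obtain U where "openin Y U" "y \<in> U" "z \<notin> U" using t1 unfolding t1_space_def by blast
    then obtain N where "N \<in> \<N>" "y \<in> N" "N \<subseteq> U" using \<N>(1) unfolding network_def by blast
    with eq \<open>z \<notin> U\<close> show False by blast
  qed
  moreover have "(\<lambda>y. {N\<in>\<N>. y \<in> N}) ` topspace Y \<subseteq> Pow \<N>" by blast
  ultimately have fin: "finite (topspace Y)"
    using \<N>(2) by (meson finite_Pow_iff inj_on_finite)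
  have "{y} \<in> \<N>" if "y \<in> topspace Y" for y
  proof -
    have "closedin Y (topspace Y - {y})"
      using t1 fin unfolding t1_space_closedin_finite by blast
    then have "openin Y {y}" using that by (simp add: closedin_def double_diff)
    then obtain N where "N \<in> \<N>" "y \<in> N" "N \<subseteq> {y}" using \<N>(1) unfolding network_def by blast
    then show ?thesis by (metis subset_singletonD empty_iff)
  qed
  then have "(\<lambda>y. {y}) ` topspace Y \<subseteq> \<N>" by blast
  then have "card (topspace Y) \<le> card \<N>"
    by (rule card_inj_on_le[rotated]) (use \<N>(2) in auto)
  with fin show ?thesis by blast
qed

section \<open>Invariance of the network weight\<close>

text \<open>The network weight may be finite, and then the transfer through countable unions and
  rational intervals is too coarse. In that case points are counted, the singletons forming a
  network of \<open>X\<close>.\<close>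

lemma network_weight_le:
  assumes X: "Tychonoff_space X" and Y: "Tychonoff_space Y" "countably_tight Y"
    and iso: "SC_p_linearly_homeomorphic X Y"
  shows "network_weight X \<le>o network_weight Y"
proof -
  obtain \<N> where \<N>: "network Y \<N>" "network_weight Y = |\<N>|"
    using network_weight_least(1) by blast
  have "\<exists>\<K>. network X \<K> \<and> |\<K>| \<le>o |\<N>|"
  proof (cases "finite \<N>")
    case False
    then show ?thesis using infinite_network_transfer[OF X Y(2) iso \<N>(1)] by blast
  next
    case True
    have t1: "t1_space X" "t1_space Y" using X Y by (auto simp: Tychonoff_space_def)
    have Ycard: "finite (topspace Y)" "card (topspace Y) \<le> card \<N>"
      using finite_network_card_le[OF t1(2) \<N>(1) True] by auto
    have Xcard: "finite (topspace X)" "card (topspace X) \<le> card (topspace Y)"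
      using finite_SC_p_linearly_homeomorphic_card_le[OF t1(1) iso Ycard(1)] by auto
    let ?K = "(\<lambda>x. {x}) ` topspace X"
    have "card ?K \<le> card \<N>" using card_image_le[OF Xcard(1)] Xcard(2) Ycard(2) by (meson le_trans)
    then have "\<exists>f. inj_on f ?K \<and> f ` ?K \<subseteq> \<N>"
      using card_le_inj[of ?K \<N>] Xcard(1) True by blast
    then have "|?K| \<le>o |\<N>|" by (simp only: card_of_ordLeq)
    moreover have "network X ?K"
      unfolding network_def using openin_subset by fastforce
    ultimately show ?thesis by blast
  qed
  then obtain \<K> where "network X \<K>" "|\<K>| \<le>o |\<N>|" by blast
  then show ?thesis using network_weight_least(2) \<N>(2) ordLeq_transitive by metis
qed

theorem corollary4:
  fixes X :: "'a topology" and Y :: "'b topology"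
  assumes "Tychonoff_space X" and "countably_tight X"
    and "Tychonoff_space Y" and "countably_tight Y"
    and "SC_p_linearly_homeomorphic X Y"
  shows "network_weight X =o network_weight Y"
  using network_weight_le[of X Y] network_weight_le[of Y X] SC_p_linearly_homeomorphic_sym[of X Y] assms
  by (simp add: ordIso_iff_ordLeq)

end
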